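(* For the rhombus game on the triangular grid with $n$ winning sets, $\mathrm{SC}_2(\mathcal G_{\lozenge},1)\ge \frac{11n}{12}-o(n)$.
   Context: An $s$-of-$k$ game on a $k$-uniform hypergraph $(V,\mathcal F)$ (winning sets are $k$-element subsets of the finite set $V$), $1\le s\le k$: Maker and Breaker alternately claim unclaimed vertices, Maker first, until all are claimed; the score is the number of winning sets in which Maker claimed at least $s$ vertices (Maker maximizes, Breaker minimizes). A pairing strategy for Maker: she fixes in advance pairwise disjoint pairs of vertices and, whenever Breaker claims a vertex of a pair whose partner is unclaimed, she claims the partner (other moves arbitrary). $\mathrm{SC}_2(\mathcal H,s)$ is the largest score Maker can guarantee against every Breaker strategy using a pairing strategy. $\mathcal G_{\lozenge}$ is the hypergraph whose vertices are the points of a finite portion of the triangular lattice and whose winning sets are the vertex sets of all rhombi formed by two unit triangles sharing an edge, in all three orientations, so $k=4$. Grids are assumed "two-dimensional": the number of winning sets within constant distance of the boundary is $o(n)$, where $n$ is the number of winning sets; $o(n)$ refers to $n\to\infty$. *)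

theory Defs
  imports Complex_Main "HOL-Library.Disjoint_Sets" "HOL-Library.Landau_Symbols"
begin

text \<open>
  A hypergraph is given by its vertex set \<open>V\<close> and its set \<open>F\<close> of winning sets.
  A strategy maps the list of moves made so far, oldest first, to the next vertex; only its
  values on lists of distinct vertices that do not exhaust \<open>V\<close> matter.
\<close>

type_synonym 'v strategy = "'v list \<Rightarrow> 'v"

definition legal_strategy :: "'v set \<Rightarrow> 'v strategy \<Rightarrow> bool" where
  "legal_strategy V \<sigma> \<longleftrightarrow> (\<forall>h. distinct h \<and> set h \<subset> V \<longrightarrow> \<sigma> h \<in> V - set h)"

text \<open>Maker moves first, so she moves exactly when the number of earlier moves is even.\<close>

primrec history :: "'v strategy \<Rightarrow> 'v strategy \<Rightarrow> nat \<Rightarrow> 'v list" where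
  "history \<sigma> \<tau> 0 = []"
| "history \<sigma> \<tau> (Suc i) =
     history \<sigma> \<tau> i @ [(if even i then \<sigma> else \<tau>) (history \<sigma> \<tau> i)]"

definition maker_claims :: "'v list \<Rightarrow> 'v set" where
  "maker_claims h = {h ! i |i. i < length h \<and> even i}"

definition score :: "'v set \<Rightarrow> 'v set set \<Rightarrow> nat \<Rightarrow> 'v strategy \<Rightarrow> 'v strategy \<Rightarrow> nat" where
  "score V F s \<sigma> \<tau> =
     card {W \<in> F. s \<le> card (W \<inter> maker_claims (history \<sigma> \<tau> (card V)))}"

definition is_pairing :: "'v set \<Rightarrow> 'v set set \<Rightarrow> bool" where
  "is_pairing V P \<longleftrightarrow> (\<forall>p\<in>P. p \<subseteq> V \<and> card p = 2) \<and> disjoint P"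

text \<open>
  Below, \<open>h @ [x]\<close> of even length is a position with Maker to move in which
  Breaker has just claimed \<open>x\<close>.
\<close>

definition follows_pairing :: "'v set \<Rightarrow> 'v set set \<Rightarrow> 'v strategy \<Rightarrow> bool" where
  "follows_pairing V P \<sigma> \<longleftrightarrow>
     (\<forall>h x y. distinct (h @ [x]) \<and> set (h @ [x]) \<subseteq> V \<and> even (length (h @ [x])) \<and>
        {x, y} \<in> P \<and> y \<notin> set (h @ [x]) \<longrightarrow> \<sigma> (h @ [x]) = y)"

text \<open>
  The pairing alone is what Maker commits to; her other moves are arbitrary, so a score counts as
  guaranteed by \<open>P\<close> only if every legal Maker strategy following \<open>P\<close> achieves it.
  (Letting her choose those moves as well would make the notion void: every strategy follows the
  empty pairing.)
\<close>

definition pairing_guarantees ::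
  "'v set \<Rightarrow> 'v set set \<Rightarrow> nat \<Rightarrow> 'v set set \<Rightarrow> nat \<Rightarrow> bool" where
  "pairing_guarantees V F s P c \<longleftrightarrow>
     (\<forall>\<sigma> \<tau>. legal_strategy V \<sigma> \<and> follows_pairing V P \<sigma> \<and> legal_strategy V \<tau> \<longrightarrow>
        c \<le> score V F s \<sigma> \<tau>)"

definition SC2 :: "'v set \<Rightarrow> 'v set set \<Rightarrow> nat \<Rightarrow> nat" where
  "SC2 V F s = Max {c. \<exists>P. is_pairing V P \<and> pairing_guarantees V F s P c}"

text \<open>
  The pair \<open>(i, j)\<close> stands for the point of the triangular lattice with coordinates
  \<open>i\<close> and \<open>j\<close> in the basis \<open>1\<close>, \<open>cis (pi / 3)\<close> of the plane.
\<close>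

type_synonym lattice_point = "int \<times> int"

definition embed :: "lattice_point \<Rightarrow> complex" where
  "embed p = of_int (fst p) + of_int (snd p) * cis (pi / 3)"

definition ldist :: "lattice_point \<Rightarrow> lattice_point \<Rightarrow> real" where
  "ldist p q = dist (embed p) (embed q)"

definition unit_triangle :: "lattice_point set \<Rightarrow> bool" where
  "unit_triangle T \<longleftrightarrow> card T = 3 \<and> (\<forall>p\<in>T. \<forall>q\<in>T. p \<noteq> q \<longrightarrow> ldist p q = 1)"

definition rhombus :: "lattice_point set \<Rightarrow> bool" where
  "rhombus R \<longleftrightarrow>
     (\<exists>T U. unit_triangle T \<and> unit_triangle U \<and> card (T \<inter> U) = 2 \<and> R = T \<union> U)"

definition rhombi :: "lattice_point set \<Rightarrow> lattice_point set set" where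
  "rhombi V = {R. rhombus R \<and> R \<subseteq> V}"

definition boundary :: "lattice_point set \<Rightarrow> lattice_point set" where
  "boundary V = {p \<in> V. \<exists>q. q \<notin> V \<and> ldist p q = 1}"

definition rhombi_near_boundary :: "lattice_point set \<Rightarrow> real \<Rightarrow> lattice_point set set" where
  "rhombi_near_boundary V d =
     {R \<in> rhombi V. \<exists>p\<in>R. \<exists>q\<in>boundary V. ldist p q \<le> d}"

text \<open>
  Meant for families along which the number of winning sets tends to infinity; that condition
  is stated separately.
\<close>

definition two_dimensional :: "(nat \<Rightarrow> lattice_point set) \<Rightarrow> bool" where
  "two_dimensional V \<longleftrightarrow>
     (\<forall>d. (\<lambda>m. real (card (rhombi_near_boundary (V m) d))) \<in> o(\<lambda>m. real (card (rhombi (V m)))))"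

end

theory Submission
  imports Defs "HOL-Library.Product_Plus"
begin

text \<open>
  Give \<open>(i, j)\<close> the colour \<open>(i + 2 j) mod 4\<close>. For every point \<open>z\<close> of colour \<open>0\<close> Maker pairs
  \<open>z\<close> with \<open>z + (1, 0)\<close> and \<open>z + (0, 1)\<close> with \<open>z + (-1, 2)\<close>. Assign to \<open>z\<close> the twelve rhombi
  whose base point is \<open>z\<close>, \<open>z + (1, 0)\<close>, \<open>z + (0, 1)\<close> or \<open>z - (1, 0)\<close>. Ten of them contain a
  pair. The other two contain \<open>z\<close> and \<open>z + (1, 0)\<close>, respectively, so Breaker cannot claim both
  of them completely. Hence Breaker gets at most one rhombus out of each dozen that lies in the
  grid, and the incomplete dozens are close to the boundary.
\<close>

section \<open>Pairing strategies\<close>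

lemma length_history [simp]: "length (history \<sigma> \<tau> i) = i"
  by (induction i) auto

lemma history_nth:
  "k < i \<Longrightarrow> history \<sigma> \<tau> i ! k = (if even k then \<sigma> else \<tau>) (history \<sigma> \<tau> k)"
  by (induction i) (auto simp: nth_append less_Suc_eq)

lemma history_legal:
  assumes "finite V" "legal_strategy V \<sigma>" "legal_strategy V \<tau>" "i \<le> card V"
  shows "distinct (history \<sigma> \<tau> i) \<and> set (history \<sigma> \<tau> i) \<subseteq> V"
  using assms(4)
proof (induction i)
  case (Suc i)
  let ?h = "history \<sigma> \<tau> i"
  have h: "distinct ?h" "set ?h \<subseteq> V"
    using Suc by auto
  have "card (set ?h) < card V"
    using h Suc.prems by (simp add: distinct_card)
  then have "set ?h \<subset> V"
    using h by auto
  then have "\<sigma> ?h \<in> V - set ?h" "\<tau> ?h \<in> V - set ?h"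
    using assms h unfolding legal_strategy_def by blast+
  then show ?case
    using h by auto
qed auto

lemma history_exhausts:
  assumes "finite V" "legal_strategy V \<sigma>" "legal_strategy V \<tau>"
  shows "set (history \<sigma> \<tau> (card V)) = V"
  using history_legal[OF assms order_refl] assms(1)
  by (intro card_subset_eq) (auto simp: distinct_card)

text \<open>All vertices are claimed in the end, so one of \<open>x\<close>, \<open>y\<close> is
  claimed first. Either Maker claims it, or Breaker does while its partner is still free, and then
  the pairing forces Maker to take the partner on her next move.\<close>

lemma maker_claims_of_pair:
  assumes "finite V" "legal_strategy V \<sigma>" "legal_strategy V \<tau>" "follows_pairing V P \<sigma>"
    and "{x, y} \<in> P" "x \<in> V" "y \<in> V" "x \<noteq> y"
  shows "x \<in> maker_claims (history \<sigma> \<tau> (card V)) \<or> y \<in> maker_claims (history \<sigma> \<tau> (card V))"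
proof -
  let ?H = "history \<sigma> \<tau>"
  let ?G = "?H (card V)"
  \<comment> \<open>Here \<open>a\<close> is the vertex claimed earlier, at time \<open>i\<close>.
    The statement is kept general in \<open>a\<close> and \<open>b\<close> so that it serves both
    orders of \<open>x\<close> and \<open>y\<close>.\<close>
  have first: "a \<in> maker_claims ?G \<or> b \<in> maker_claims ?G"
    if ab: "{a, b} \<in> P" and i: "i < j" "j < card V" "?G ! i = a" "?G ! j = b" for a b i j
  proof (cases "even i")
    case True
    then show ?thesis
      using i unfolding maker_claims_def by fastforce
  next
    case False
    have \<tau>: "\<tau> (?H i) = a"
      using history_nth[of i "card V" \<sigma> \<tau>] i False by auto
    have legal: "distinct (?H (Suc i))" "set (?H (Suc i)) \<subseteq> V"
      using history_legal[OF assms(1-3), of "Suc i"] i by auto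
    have "b \<notin> set (?H (Suc i))"
    proof
      assume "b \<in> set (?H (Suc i))"
      then obtain k where k: "k < Suc i" "?H (Suc i) ! k = b"
        by (metis in_set_conv_nth length_history)
      then have "?G ! k = b"
        using history_nth[of k "Suc i" \<sigma> \<tau>] history_nth[of k "card V" \<sigma> \<tau>] i by simp
      moreover have "distinct ?G"
        using history_legal[OF assms(1-3)] by auto
      ultimately show False
        using i k(1) nth_eq_iff_index_eq[of ?G k j] by auto
    qed
    then have "\<sigma> (?H (Suc i)) = b"
      using assms(4) ab legal False \<tau> unfolding follows_pairing_def by simp
    then have "?G ! Suc i = b"
      using history_nth[of "Suc i" "card V" \<sigma> \<tau>] False i by simp
    \<comment> \<open>Maker's reply at time \<open>Suc i\<close> still falls within the game,
      because \<open>b\<close> is claimed at some time \<open>j > i\<close>.\<close>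
    moreover have "Suc i < card V" "even (Suc i)"
      using i False by auto
    ultimately show ?thesis
      unfolding maker_claims_def by force
  qed
  have "x \<in> set ?G" "y \<in> set ?G"
    using history_exhausts[OF assms(1-3)] assms(6,7) by auto
  then obtain i j where "i < card V" "?G ! i = x" "j < card V" "?G ! j = y"
    by (metis in_set_conv_nth length_history)
  moreover from this have "i < j \<or> j < i"
    using assms(8) by (metis linorder_neqE_nat)
  moreover have "{y, x} \<in> P"
    using assms(5) by (simp add: insert_commute)
  ultimately show ?thesis
    using first assms(5) by blast
qed

section \<open>Existence of strategies and lower bounds for \<open>SC2\<close>\<close>

lemma ex_legal_strategy: "\<exists>\<sigma>. legal_strategy V \<sigma>"
proof -
  have "legal_strategy V (\<lambda>h. SOME v. v \<in> V - set h)"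
    unfolding legal_strategy_def by (metis (mono_tags) psubset_imp_ex_mem someI_ex)
  then show ?thesis by blast
qed

lemma pairing_partner_unique:
  assumes "is_pairing V P" "{x, y} \<in> P" "{x, z} \<in> P"
  shows "y = z"
proof -
  have "{x, y} = {x, z}"
    using assms disjointD[of P "{x, y}" "{x, z}"] unfolding is_pairing_def by auto
  then show ?thesis
    by (metis doubleton_eq_iff)
qed

lemma ex_legal_strategy_following:
  assumes P: "is_pairing V P"
  shows "\<exists>\<sigma>. legal_strategy V \<sigma> \<and> follows_pairing V P \<sigma>"
proof -
  obtain \<sigma>0 where \<sigma>0: "legal_strategy V \<sigma>0"
    using ex_legal_strategy by blast
  \<comment> \<open>The parity of \<open>h\<close> is ignored: answering the last move is legal
    whoever made it, since the partner is a free vertex of \<open>V\<close>.\<close>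
  define reply where "reply h y \<longleftrightarrow> h \<noteq> [] \<and> {last h, y} \<in> P \<and> y \<notin> set h"
    for h :: "'a list" and y
  define \<sigma> where "\<sigma> h = (if \<exists>y. reply h y then SOME y. reply h y else \<sigma>0 h)" for h
  have \<sigma>: "\<sigma> h = y" if "reply h y" for h y
  proof -
    have "(SOME y. reply h y) = y"
      using that pairing_partner_unique[OF P] unfolding reply_def by (intro some_equality) blast+
    then show ?thesis
      using that unfolding \<sigma>_def by auto
  qed
  have "\<sigma> h \<in> V - set h" if h: "distinct h" "set h \<subset> V" for h
  proof (cases "\<exists>y. reply h y")
    case True
    then obtain y where y: "reply h y"
      by blast
    then have "y \<in> V"
      using P unfolding reply_def is_pairing_def by blast
    then show ?thesis
      using \<sigma>[OF y] y unfolding reply_def by auto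
  next
    case False
    then show ?thesis
      using \<sigma>0 h unfolding legal_strategy_def \<sigma>_def by auto
  qed
  moreover have "follows_pairing V P \<sigma>"
    unfolding follows_pairing_def using \<sigma> by (auto simp: reply_def)
  ultimately show ?thesis
    unfolding legal_strategy_def by blast
qed

text \<open>\<open>Max\<close> is meaningful only on a finite set. A guarantee is never vacuous,
  because for every pairing some legal play follows it; the score of that play bounds each
  guaranteed value by \<open>card F\<close>.\<close>

lemma SC2_ge:
  assumes "finite F" "is_pairing V P" "pairing_guarantees V F s P c"
  shows "c \<le> SC2 V F s"
proof -
  have "c' \<le> card F" if P': "is_pairing V P'" "pairing_guarantees V F s P' c'" for P' c'
  proof -
    obtain \<sigma> \<tau> where "legal_strategy V \<sigma>" "follows_pairing V P' \<sigma>" "legal_strategy V \<tau>"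
      using ex_legal_strategy_following[OF P'(1)] by blast
    then have "c' \<le> score V F s \<sigma> \<tau>"
      using P'(2) unfolding pairing_guarantees_def by blast
    also have "\<dots> \<le> card F"
      unfolding score_def using assms(1) by (intro card_mono) auto
    finally show ?thesis .
  qed
  then have "{c. \<exists>P. is_pairing V P \<and> pairing_guarantees V F s P c} \<subseteq> {..card F}"
    by blast
  then have "finite {c. \<exists>P. is_pairing V P \<and> pairing_guarantees V F s P c}"
    by (rule finite_subset) simp
  then show ?thesis
    unfolding SC2_def using assms(2,3) by (intro Max_ge) auto
qed

section \<open>Rhombi of the triangular lattice\<close>

text \<open>The six sixth roots of unity in lattice coordinates, that is, the neighbours of the
  origin.\<close>

definition unit_steps :: "lattice_point set" where
  "unit_steps = {(1, 0), (0, 1), (-1, 1), (-1, 0), (0, -1), (1, -1)}"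

lemma ldist_eq: "ldist p q = norm (of_int (fst p - fst q) + of_int (snd p - snd q) * cis (pi / 3))"
  unfolding ldist_def embed_def dist_norm by (simp add: algebra_simps)

text \<open>The norm form of the Eisenstein lattice: the mixed term has coefficient
  \<open>2 * cos (pi / 3) = 1\<close>.\<close>

lemma ldist_sq:
  "(ldist p q)\<^sup>2 = of_int ((fst p - fst q)\<^sup>2 + (fst p - fst q) * (snd p - snd q) + (snd p - snd q)\<^sup>2)"
  unfolding ldist_eq cmod_power2
  by (simp add: cos_60 sin_60 power2_eq_square algebra_simps)

lemma norm_form_eq_1_iff:
  fixes x y :: int
  shows "x\<^sup>2 + x * y + y\<^sup>2 = 1 \<longleftrightarrow> (x, y) \<in> unit_steps"
proof
  assume *: "x\<^sup>2 + x * y + y\<^sup>2 = 1"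
  \<comment> \<open>Completing the square: four times the form is
    \<open>(2 * x + y)\<^sup>2 + 3 * y\<^sup>2\<close>, and likewise with \<open>x\<close> and
    \<open>y\<close> exchanged.\<close>
  have "3 * y\<^sup>2 \<le> 4" "3 * x\<^sup>2 \<le> 4"
    using * zero_le_power2[of "2 * x + y"] zero_le_power2[of "x + 2 * y"]
    by (auto simp: power2_eq_square algebra_simps)
  then have "\<bar>y\<bar> < 2" "\<bar>x\<bar> < 2"
    using power_mono[of 2 "\<bar>y\<bar>" 2] power_mono[of 2 "\<bar>x\<bar>" 2] by (auto simp: not_less[symmetric])
  then have "x \<in> {-1, 0, 1}" "y \<in> {-1, 0, 1}"
    by auto
  then show "(x, y) \<in> unit_steps"
    using * unfolding unit_steps_def by auto
qed (auto simp: unit_steps_def)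

lemma ldist_eq_1_iff: "ldist p q = 1 \<longleftrightarrow> p - q \<in> unit_steps"
proof -
  have "ldist p q = 1 \<longleftrightarrow> (ldist p q)\<^sup>2 = 1"
    by (simp add: ldist_def power2_eq_1_iff) (smt (verit) zero_le_dist)
  also have "\<dots> \<longleftrightarrow> (fst p - fst q)\<^sup>2 + (fst p - fst q) * (snd p - snd q) + (snd p - snd q)\<^sup>2 = 1"
    unfolding ldist_sq of_int_eq_1_iff ..
  also have "\<dots> \<longleftrightarrow> (fst p - fst q, snd p - snd q) \<in> unit_steps"
    by (rule norm_form_eq_1_iff)
  finally show ?thesis
    by (simp add: minus_prod_def)
qed

lemma ldist_le: "ldist (i + x, j + y) (i, j) \<le> of_int (\<bar>x\<bar> + \<bar>y\<bar>)"
proof -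
  have "ldist (i + x, j + y) (i, j) \<le> norm (of_int x :: complex) + norm (of_int y * cis (pi / 3))"
    unfolding ldist_eq using norm_triangle_ineq by (simp del: norm_of_int)
  then show ?thesis
    by (simp add: norm_mult)
qed

text \<open>The index \<open>t\<close> is the orientation. The edge shared by the two triangles is
  parallel to \<open>(-1, 1)\<close> for \<open>t = 0\<close>, to \<open>(1, 0)\<close> for
  \<open>t = 1\<close> and to \<open>(0, 1)\<close> for \<open>t = 2\<close>.\<close>

definition base_rhombus :: "nat \<Rightarrow> lattice_point \<Rightarrow> lattice_point set" where
  "base_rhombus t p = (case p of (i, j) \<Rightarrow>
     if t = 0 then {(i, j), (i + 1, j), (i, j + 1), (i + 1, j + 1)}
     else if t = 1 then {(i, j), (i, j + 1), (i - 1, j + 1), (i - 1, j + 2)}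
     else {(i, j), (i + 1, j), (i - 1, j + 1), (i, j + 1)})"

text \<open>The coordinate sums over the four vertices, taken modulo 4, are \<open>(2, 2)\<close>,
  \<open>(2, 0)\<close> and \<open>(0, 2)\<close> for the three orientations. So they reveal
  \<open>t\<close>, and then the base point.\<close>

lemma base_rhombus_inj:
  assumes "base_rhombus t p = base_rhombus t' p'" "t < 3" "t' < 3"
  shows "t = t' \<and> p = p'"
proof -
  obtain i j i' j' where p: "p = (i, j)" "p' = (i', j')"
    by fastforce
  have sums: "sum fst (base_rhombus t (i, j)) = 4 * i + (if t = 0 then 2 else if t = 1 then -2 else 0)"
    "sum snd (base_rhombus t (i, j)) = 4 * j + (if t = 1 then 4 else 2)" for t i j
    by (simp_all add: base_rhombus_def)
  have "4 * i + (if t = 0 then 2 else if t = 1 then -2 else 0) =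
      4 * i' + (if t' = 0 then 2 else if t' = 1 then -2 else 0)"
    "4 * j + (if t = 1 then 4 else 2) = 4 * j' + (if t' = 1 then 4 else (2::int))"
    using assms(1) unfolding p by (metis sums)+
  moreover have "t = 0 \<or> t = 1 \<or> t = 2" "t' = 0 \<or> t' = 1 \<or> t' = 2"
    using assms by auto
  ultimately show ?thesis
    unfolding p prod.inject by presburger
qed

lemma unit_triangleD:
  assumes "unit_triangle T" "p \<in> T" "q \<in> T" "p \<noteq> q"
  shows "p - q \<in> unit_steps"
  using assms unfolding unit_triangle_def ldist_eq_1_iff by blast

text \<open>Rotations by 60 degrees, in lattice coordinates.\<close>

definition rot_left :: "lattice_point \<Rightarrow> lattice_point" where
  "rot_left u = (- snd u, fst u + snd u)"

definition rot_right :: "lattice_point \<Rightarrow> lattice_point" where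
  "rot_right u = (fst u + snd u, - fst u)"

lemma unit_steps_common_neighbour:
  assumes "u \<in> unit_steps" "v \<in> unit_steps" "v - u \<in> unit_steps"
  shows "v \<in> {rot_left u, rot_right u}"
proof -
  obtain a b x y where uv: "u = (a, b)" "v = (x, y)"
    by fastforce
  have "(x - a, y - b) \<in> unit_steps"
    using assms(3) unfolding uv by simp
  then have "x = - b \<and> y = a + b \<or> x = a + b \<and> y = - a"
    using assms(1,2) unfolding uv unit_steps_def insert_iff empty_iff prod.inject by presburger
  then show ?thesis
    unfolding uv rot_left_def rot_right_def by auto
qed

text \<open>The shared edge determines the rhombus: its two outer vertices are distinct common
  neighbours of the ends of the edge, and there are only two such neighbours.\<close>

lemma rhombus_imp_base_rhombus:
  assumes "rhombus R"
  shows "\<exists>t<3. \<exists>p. R = base_rhombus t p"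
proof -
  obtain T U where T: "unit_triangle T" and U: "unit_triangle U" and TU: "card (T \<inter> U) = 2"
    and R: "R = T \<union> U"
    using assms unfolding rhombus_def by blast
  obtain a b where ab: "T \<inter> U = {a, b}" "a \<noteq> b"
    using TU by (meson card_2_iff)
  have card: "card T = 3" "card U = 3"
    using T U unfolding unit_triangle_def by auto
  have "\<exists>c. S = {a, b, c} \<and> c \<noteq> a \<and> c \<noteq> b" if "card S = 3" "{a, b} \<subseteq> S" for S
  proof -
    have "finite S"
      using that(1) card_ge_0_finite by force
    then have "card (S - {a, b}) = 1"
      using that ab(2) by (simp add: card_Diff_subset)
    then obtain c where "S - {a, b} = {c}"
      by (meson card_1_singletonE)
    then show ?thesis
      using that(2) by blast
  qed
  then obtain c d where c: "T = {a, b, c}" "c \<noteq> a" "c \<noteq> b" and d: "U = {a, b, d}" "d \<noteq> a" "d \<noteq> b"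
    using card ab by (metis Int_lower1 Int_lower2)
  have cd: "c \<noteq> d"
    using ab c d by auto
  have steps: "b - a \<in> unit_steps" "c - a \<in> unit_steps" "c - b \<in> unit_steps"
    "d - a \<in> unit_steps" "d - b \<in> unit_steps"
    using unit_triangleD[OF T] unit_triangleD[OF U] c d ab(2) by auto
  define i j where "i = fst a" and "j = snd a"
  obtain u v w where uvw: "b = a + u" "c = a + v" "d = a + w"
    by (metis add_diff_cancel_left' diff_add_cancel add.commute)
  have a: "a = (i, j)"
    by (simp add: i_def j_def)
  have u: "u \<in> unit_steps" "v \<in> unit_steps" "w \<in> unit_steps" "v - u \<in> unit_steps"
    "w - u \<in> unit_steps" "v \<noteq> w"
    using steps cd unfolding uvw by (auto simp: algebra_simps)
  have R': "R = {a, a + u, a + v, a + w}"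
    using R c d uvw by auto
  have "v \<in> {rot_left u, rot_right u}" "w \<in> {rot_left u, rot_right u}"
    using u unit_steps_common_neighbour by blast+
  then have "{v, w} = {rot_left u, rot_right u}"
    using u(6) by auto
  then have R_rot: "R = {a, a + u, a + rot_left u, a + rot_right u}"
    using R' by (auto simp: doubleton_eq_iff)
  \<comment> \<open>One entry for each of the six directions of \<open>u\<close>; opposite
    directions give the same orientation and stand next to each other.\<close>
  have "R \<in> {base_rhombus 1 (i + 1, j - 1), base_rhombus 1 (i, j - 1), base_rhombus 2 (i, j),
      base_rhombus 2 (i, j - 1), base_rhombus 0 (i - 1, j), base_rhombus 0 (i, j - 1)}"
    using u(1) unfolding R_rot a base_rhombus_def unit_steps_def rot_left_def rot_right_def
    by (elim insertE) (simp_all add: insert_commute add.commute)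
  then obtain t s where "R = base_rhombus t s" "t = 0 \<or> t = 1 \<or> t = 2"
    by blast
  then show ?thesis
    by (intro exI[of _ t] conjI exI[of _ s]) auto
qed

lemma rhombus_base_rhombus:
  assumes "t < 3"
  shows "rhombus (base_rhombus t p)"
proof -
  obtain i j where p: "p = (i, j)"
    by fastforce
  have tri: "unit_triangle {p, q, r}"
    if "p - q \<in> unit_steps" "p - r \<in> unit_steps" "q - r \<in> unit_steps" for p q r
  proof -
    have "p \<noteq> q" "p \<noteq> r" "q \<noteq> r"
      using that by (auto simp: unit_steps_def zero_prod_def)
    moreover have "- x \<in> unit_steps" if "x \<in> unit_steps" for x
      using that by (auto simp: unit_steps_def)
    then have "q - p \<in> unit_steps" "r - p \<in> unit_steps" "r - q \<in> unit_steps"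
      using that by (metis minus_diff_eq)+
    ultimately show ?thesis
      using that unfolding unit_triangle_def ldist_eq_1_iff by auto
  qed
  have "t = 0 \<or> t = 1 \<or> t = 2"
    using assms by auto
  then show ?thesis
  proof (elim disjE)
    assume "t = 0"
    then show ?thesis
      unfolding rhombus_def p
      by (intro exI[of _ "{(i, j), (i + 1, j), (i, j + 1)}"]
          exI[of _ "{(i + 1, j + 1), (i + 1, j), (i, j + 1)}"] conjI tri)
        (auto simp: unit_steps_def base_rhombus_def card_insert_if)
  next
    assume "t = 1"
    then show ?thesis
      unfolding rhombus_def p
      by (intro exI[of _ "{(i, j), (i, j + 1), (i - 1, j + 1)}"]
          exI[of _ "{(i - 1, j + 2), (i, j + 1), (i - 1, j + 1)}"] conjI tri)
        (auto simp: unit_steps_def base_rhombus_def card_insert_if)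
  next
    assume "t = 2"
    then show ?thesis
      unfolding rhombus_def p
      by (intro exI[of _ "{(i, j), (i + 1, j), (i, j + 1)}"]
          exI[of _ "{(i, j), (i - 1, j + 1), (i, j + 1)}"] conjI tri)
        (auto simp: unit_steps_def base_rhombus_def card_insert_if)
  qed
qed

lemma finite_rhombi: "finite V \<Longrightarrow> finite (rhombi V)"
  unfolding rhombi_def by (rule finite_subset[of _ "Pow V"]) auto

text \<open>Walk from \<open>(i, j)\<close> by unit steps along the two axes. Each point before the
  last lies in \<open>V\<close> and is too close to \<open>(i, j)\<close> to be a boundary point, so
  all its neighbours lie in \<open>V\<close> as well.\<close>

lemma near_point_in_grid:
  assumes "(i, j) \<in> V" "\<And>b. b \<in> boundary V \<Longrightarrow> real k < ldist (i, j) b"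
    and "\<bar>x\<bar> + \<bar>y\<bar> \<le> int k"
  shows "(i + x, j + y) \<in> V"
  using assms(2,3)
proof (induction k arbitrary: x y)
  case 0
  then have "x = 0" "y = 0"
    by auto
  then show ?case
    using assms(1) by simp
next
  case (Suc k)
  show ?case
  proof (cases "\<bar>x\<bar> + \<bar>y\<bar> \<le> int k")
    case True
    show ?thesis
      using Suc.IH[OF _ True] Suc.prems(1) by force
  next
    case False
    then have "x \<noteq> 0 \<or> y \<noteq> 0"
      by auto
    then obtain x' y' where xy: "\<bar>x'\<bar> + \<bar>y'\<bar> \<le> int k" "(x' - x, y' - y) \<in> unit_steps"
    proof
      assume "x \<noteq> 0"
      then show thesis
        using Suc.prems(2) by (intro that[of "x - sgn x" y]) (auto simp: unit_steps_def sgn_if)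
    next
      assume "y \<noteq> 0"
      then show thesis
        using Suc.prems(2) by (intro that[of x "y - sgn y"]) (auto simp: unit_steps_def sgn_if)
    qed
    let ?q = "(i + x', j + y')"
    have "?q \<in> V"
      using Suc.IH[OF _ xy(1)] Suc.prems(1) by force
    moreover have "ldist (i, j) ?q \<le> real (Suc k)"
      using ldist_le[of i x' j y'] xy(1) unfolding ldist_def dist_commute[of "embed (i, j)"] by linarith
    then have "?q \<notin> boundary V"
      using Suc.prems(1)[of ?q] by linarith
    moreover have "ldist ?q (i + x, j + y) = 1"
      unfolding ldist_eq_1_iff using xy(2) by (simp add: algebra_simps)
    ultimately show ?thesis
      unfolding boundary_def by blast
  qed
qed

section \<open>The pairing\<close>

text \<open>Both steps used by the pairing, \<open>(1, 0)\<close> and \<open>(-1, 1)\<close>, raise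
  the colour by one: the first joins colour 0 to 1, the second colour 2 to 3.\<close>

definition colour :: "lattice_point \<Rightarrow> int" where
  "colour p = (fst p + 2 * snd p) mod 4"

definition grid_pairs :: "lattice_point set \<Rightarrow> lattice_point set set" where
  "grid_pairs V =
     {{(i, j), (i + 1, j)} |i j. colour (i, j) = 0 \<and> (i, j) \<in> V \<and> (i + 1, j) \<in> V} \<union>
     {{(i, j), (i - 1, j + 1)} |i j. colour (i, j) = 2 \<and> (i, j) \<in> V \<and> (i - 1, j + 1) \<in> V}"

lemma grid_pairs_row:
  assumes "colour (i, j) = 0" "(i, j) \<in> V" "(i', j) \<in> V" "i' = i + 1"
  shows "{(i, j), (i', j)} \<in> grid_pairs V"
  using assms(1-3) unfolding grid_pairs_def assms(4) by blast

text \<open>The colour of a point tells its role in a pair and hence where its partner is, which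
  makes distinct pairs disjoint.\<close>

lemma grid_pairs_of_point:
  assumes "p \<in> grid_pairs V" "(a, b) \<in> p"
  shows "p = (if colour (a, b) = 0 then {(a, b), (a + 1, b)}
    else if colour (a, b) = 1 then {(a - 1, b), (a, b)}
    else if colour (a, b) = 2 then {(a, b), (a - 1, b + 1)}
    else {(a + 1, b - 1), (a, b)})"
proof -
  from assms(1) consider
      i j where "p = {(i, j), (i + 1, j)}" "colour (i, j) = 0"
    | i j where "p = {(i, j), (i - 1, j + 1)}" "colour (i, j) = 2"
    unfolding grid_pairs_def by blast
  then show ?thesis
  proof cases
    case (1 i j)
    then have "colour (i + 1, j) = 1"
      unfolding colour_def fst_conv snd_conv by presburger
    then show ?thesis
      using 1 assms(2) by auto
  next
    case (2 i j)
    then have "colour (i - 1, j + 1) = 3"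
      unfolding colour_def fst_conv snd_conv by presburger
    then show ?thesis
      using 2 assms(2) by auto
  qed
qed

lemma grid_pairs_pairing: "is_pairing V (grid_pairs V)"
proof -
  have "p = q" if "p \<in> grid_pairs V" "q \<in> grid_pairs V" "z \<in> p" "z \<in> q" for p q z
    using grid_pairs_of_point that by (cases z) metis
  then have "disjoint (grid_pairs V)"
    unfolding disjoint_def by blast
  moreover have "p \<subseteq> V \<and> card p = 2" if "p \<in> grid_pairs V" for p
    using that unfolding grid_pairs_def by auto
  ultimately show ?thesis
    unfolding is_pairing_def by blast
qed

section \<open>Dozens of rhombi and the count of lost ones\<close>

definition dozen_base :: "nat \<Rightarrow> lattice_point \<Rightarrow> lattice_point" where
  "dozen_base k p = (case p of (i, j) \<Rightarrow>
     if k = 0 then (i, j) else if k = 1 then (i + 1, j) else if k = 2 then (i, j + 1) else (i - 1, j))"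

text \<open>For \<open>z\<close> of colour 0 the colour of \<open>dozen_base k z\<close> is
  \<open>k\<close>, so a base point reveals \<open>k\<close> and then \<open>z\<close>. Hence
  different dozens share no rhombus.\<close>

lemma dozen_inj:
  "inj_on (\<lambda>(z, k, t). base_rhombus t (dozen_base k z)) ({z. colour z = 0} \<times> {..<4} \<times> {..<3})"
proof (rule inj_onI, clarsimp)
  fix i j k t i' j' k' t'
  assume *: "colour (i, j) = 0" "colour (i', j') = 0" "k < (4::nat)" "k' < (4::nat)" "t < 3" "t' < 3"
    and eq: "base_rhombus t (dozen_base k (i, j)) = base_rhombus t' (dozen_base k' (i', j'))"
  have "t = t'" "dozen_base k (i, j) = dozen_base k' (i', j')"
    using base_rhombus_inj[OF eq] * by auto
  moreover have "k \<in> {0, 1, 2, 3}" "k' \<in> {0, 1, 2, 3}"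
    using * by auto
  ultimately show "i = i' \<and> j = j' \<and> k = k' \<and> t = t'"
    using *(1,2) unfolding dozen_base_def colour_def by (auto; presburger)
qed

text \<open>A check of the twelve combinations of orientation and colour of the base point. Only
  \<open>t = 1\<close> with colour 1 and \<open>t = 0\<close> with colour 3 leave the rhombus
  without a pair.\<close>

lemma lost_base_rhombus:
  assumes "base_rhombus t (i, j) \<subseteq> V" "t < 3"
    and "\<And>x y. {x, y} \<in> grid_pairs V \<Longrightarrow> \<not> {x, y} \<subseteq> base_rhombus t (i, j)"
  shows "t = 1 \<and> colour (i - 1, j) = 0 \<or> t = 0 \<and> colour (i + 1, j) = 0"
proof -
  have h: "\<not> ({(a, b), (a + 1, b)} \<subseteq> base_rhombus t (i, j))" if "colour (a, b) = 0" for a b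
    using assms(1) assms(3)[of "(a, b)" "(a + 1, b)"] that unfolding grid_pairs_def by blast
  have d: "\<not> ({(a, b), (a - 1, b + 1)} \<subseteq> base_rhombus t (i, j))" if "colour (a, b) = 2" for a b
    using assms(1) assms(3)[of "(a, b)" "(a - 1, b + 1)"] that unfolding grid_pairs_def by blast
  have "colour (i, j) \<in> {0, 1, 2, 3}"
    unfolding colour_def by (auto; presburger)
  moreover have "t \<in> {0, 1, 2}"
    using assms(2) by auto
  moreover have "colour (i, j) = 3" if "t = 0"
    using h[of i j] h[of i "j + 1"] d[of "i + 1" j] calculation that
    by (auto simp: base_rhombus_def colour_def; presburger)
  moreover have "colour (i, j) = 1" if "t = 1"
    using h[of "i - 1" "j + 1"] d[of i j] d[of i "j + 1"] calculation(1) that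
    by (auto simp: base_rhombus_def colour_def algebra_simps; presburger)
  moreover have "t \<noteq> 2"
  proof
    assume "t = 2"
    then show False
      using h[of i j] h[of "i - 1" "j + 1"] d[of i j] d[of "i + 1" j] calculation(1)
      by (auto simp: base_rhombus_def colour_def; presburger)
  qed
  ultimately show ?thesis
    unfolding colour_def by (auto; presburger)
qed

text \<open>\<open>L\<close> stands for the rhombi that Breaker claims completely. The hypothesis
  concerns \<open>\<Union>L\<close> rather than single members, because it must also exclude two
  rhombi of \<open>L\<close> that meet a common pair in different points.\<close>

lemma card_lost:
  assumes "finite V" "L \<subseteq> rhombi V"
    and lost: "\<And>x y. {x, y} \<in> grid_pairs V \<Longrightarrow> \<not> {x, y} \<subseteq> \<Union>L"
  shows "12 * card (L - rhombi_near_boundary V 10) \<le> card (rhombi V)"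
proof -
  define D where "D = L - rhombi_near_boundary V 10"
  \<comment> \<open>\<open>g z\<close> picks one of the two pair-free rhombi in the dozen of
    \<open>z\<close>. The fallback may lie outside \<open>D\<close>, so \<open>Z\<close> keeps only
    those \<open>z\<close> for which \<open>g z\<close> is lost.\<close>
  define g where "g z = (let R = base_rhombus 1 (dozen_base 1 z) in
    if R \<in> D then R else base_rhombus 0 (dozen_base 3 z))" for z
  define Z where "Z = {z. colour z = 0 \<and> g z \<in> D}"
  have dozen: "base_rhombus t (dozen_base k z) \<in> rhombi V"
    if z: "z \<in> Z" and kt: "k < 4" "t < 3" for z k t
  proof -
    obtain i j where ij: "z = (i, j)"
      by fastforce
    obtain t' e where te: "g z = base_rhombus t' (i + e, j)" "e \<in> {-1, 1}"
      unfolding g_def Let_def ij dozen_base_def by (cases "base_rhombus 1 (i + 1, j) \<in> D") force+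
    have p: "(i + e, j) \<in> g z"
      unfolding te base_rhombus_def by auto
    have gz: "g z \<in> rhombi V" "g z \<notin> rhombi_near_boundary V 10"
      using z assms(2) unfolding Z_def D_def by auto
    have "(i + e, j) \<in> V"
      using gz(1) p unfolding rhombi_def by blast
    moreover have "real 10 < ldist (i + e, j) b" if "b \<in> boundary V" for b
      using gz p that unfolding rhombi_near_boundary_def by force
    ultimately have *: "(i + e + (x - e), j + y) \<in> V" if "\<bar>x - e\<bar> + \<bar>y\<bar> \<le> int 10" for x y
      using near_point_in_grid that by blast
    \<comment> \<open>These offsets cover the whole dozen. Measured from \<open>(i + e, j)\<close>
      they take at most 4 + 3 = 7 axis steps, within the margin of 10.\<close>
    have near: "(i + x, j + y) \<in> V" if "\<bar>x\<bar> \<le> 3" "\<bar>y\<bar> \<le> 3" for x y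
      using *[of x y] that te(2) by auto
    have "base_rhombus t (dozen_base k z) \<subseteq> V"
      using near[of 0 0] near[of 1 0] near[of 2 0] near[of "-1" 0] near[of "-2" 0]
        near[of 0 1] near[of 1 1] near[of 2 1] near[of "-1" 1] near[of "-2" 1]
        near[of 0 2] near[of 1 2] near[of 2 2] near[of "-1" 2] near[of "-2" 2]
        near[of 0 3] near[of 1 3] near[of 2 3] near[of "-1" 3] near[of "-2" 3]
      unfolding base_rhombus_def dozen_base_def ij by (auto simp: algebra_simps)
    then show ?thesis
      using rhombus_base_rhombus[OF kt(2)] unfolding rhombi_def by blast
  qed
  have "R \<in> g ` Z" if "R \<in> D" for R
  proof -
    have RL: "R \<in> L" "R \<in> rhombi V"
      using that assms(2) unfolding D_def by auto
    then obtain t i j where R: "R = base_rhombus t (i, j)" "t < 3"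
      using rhombus_imp_base_rhombus unfolding rhombi_def by fastforce
    have "t = 1 \<and> colour (i - 1, j) = 0 \<or> t = 0 \<and> colour (i + 1, j) = 0"
    proof (rule lost_base_rhombus)
      show "base_rhombus t (i, j) \<subseteq> V"
        using RL R unfolding rhombi_def by blast
    next
      fix x y
      assume "{x, y} \<in> grid_pairs V"
      then show "\<not> {x, y} \<subseteq> base_rhombus t (i, j)"
        using lost RL R by blast
    qed (rule R(2))
    then show ?thesis
    proof (elim disjE conjE)
      assume t: "t = 1" "colour (i - 1, j) = 0"
      then have "g (i - 1, j) = R"
        using that R unfolding g_def dozen_base_def by simp
      then show ?thesis
        using that t(2) unfolding Z_def by blast
    next
      assume t: "t = 0" "colour (i + 1, j) = 0"
      \<comment> \<open>This is the other pair-free rhombus of the dozen of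
        \<open>(i + 1, j)\<close>. If it were lost too, Breaker would own both
        \<open>(i + 1, j)\<close> and its partner \<open>(i + 2, j)\<close>.\<close>
      have "base_rhombus 1 (i + 2, j) \<notin> D"
      proof
        assume D: "base_rhombus 1 (i + 2, j) \<in> D"
        have "(i + 2, j) \<in> base_rhombus 1 (i + 2, j)" "(i + 1, j) \<in> R"
          unfolding R t by (auto simp: base_rhombus_def)
        then have "{(i + 1, j), (i + 2, j)} \<subseteq> \<Union>L"
          using D RL unfolding D_def by blast
        moreover from this have V: "(i + 1, j) \<in> V" "(i + 2, j) \<in> V"
          using assms(2) unfolding rhombi_def by blast+
        have "{(i + 1, j), (i + 2, j)} \<in> grid_pairs V"
          using grid_pairs_row[OF t(2) V] by simp
        ultimately show False
          using lost[of "(i + 1, j)" "(i + 2, j)"] by simp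
      qed
      then have "g (i + 1, j) = R"
        using R t unfolding g_def dozen_base_def by (simp add: algebra_simps)
      then show ?thesis
        using that t(2) unfolding Z_def by blast
    qed
  qed
  then have "D \<subseteq> g ` Z"
    by blast
  let ?f = "\<lambda>(z, k, t). base_rhombus t (dozen_base k z)"
  let ?X = "Z \<times> {..<4::nat} \<times> {..<3::nat}"
  have inj: "inj_on ?f ?X"
    by (rule inj_on_subset[OF dozen_inj]) (auto simp: Z_def)
  have im: "?f ` ?X \<subseteq> rhombi V"
    using dozen by auto
  \<comment> \<open>\<open>Z\<close> is cut out of the whole lattice; its finiteness comes from the
    injection of the dozens into \<open>rhombi V\<close>.\<close>
  have "finite ?X"
    using finite_imageD[OF finite_subset[OF im finite_rhombi[OF assms(1)]] inj] .
  then have finZ: "finite Z"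
    by (rule finite_cartesian_productD1) (auto simp: lessThan_empty_iff)
  have "card D \<le> card Z"
    using \<open>D \<subseteq> g ` Z\<close> finZ surj_card_le by blast
  moreover have "12 * card Z = card (Z \<times> {..<4::nat} \<times> {..<3::nat})"
    by (simp add: card_cartesian_product)
  moreover have "\<dots> \<le> card (rhombi V)"
    by (rule card_inj_on_le[OF inj im finite_rhombi[OF assms(1)]])
  ultimately show ?thesis
    unfolding D_def by linarith
qed

section \<open>The guaranteed score and the asymptotic bound\<close>

lemma grid_pairs_guarantee:
  assumes "finite V"
  shows "pairing_guarantees V (rhombi V) 1 (grid_pairs V)
    (card (rhombi V) - (card (rhombi V) div 12 + card (rhombi_near_boundary V 10)))"
  unfolding pairing_guarantees_def
proof (intro allI impI, elim conjE)
  fix \<sigma> \<tau>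
  assume \<sigma>: "legal_strategy V \<sigma>" "follows_pairing V (grid_pairs V) \<sigma>" and \<tau>: "legal_strategy V \<tau>"
  define M where "M = maker_claims (history \<sigma> \<tau> (card V))"
  define L where "L = {R \<in> rhombi V. R \<inter> M = {}}"
  let ?N = "rhombi_near_boundary V 10"
  have fin: "finite (rhombi V)"
    by (rule finite_rhombi[OF assms])
  have "\<not> {x, y} \<subseteq> \<Union>L" if xy: "{x, y} \<in> grid_pairs V" for x y
  proof -
    have "x \<in> V" "y \<in> V" "x \<noteq> y"
      using xy grid_pairs_pairing[of V] unfolding is_pairing_def by force+
    then have "x \<in> M \<or> y \<in> M"
      unfolding M_def using maker_claims_of_pair[OF assms \<sigma>(1) \<tau> \<sigma>(2) xy] by blast
    then show ?thesis
      unfolding L_def by blast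
  qed
  then have "12 * card (L - ?N) \<le> card (rhombi V)"
    using card_lost[OF assms, of L] unfolding L_def by blast
  then have "card (L - ?N) \<le> card (rhombi V) div 12"
    by linarith
  moreover have "finite ?N"
    using fin unfolding rhombi_near_boundary_def by auto
  then have "card L \<le> card (L - ?N) + card ?N"
    using fin by (metis card_Diff_subset_Int diff_card_le_card_Diff le_diff_conv)
  moreover have "score V (rhombi V) 1 \<sigma> \<tau> = card (rhombi V - L)"
  proof -
    have "1 \<le> card (R \<inter> M) \<longleftrightarrow> R \<inter> M \<noteq> {}" if "R \<in> rhombi V" for R
    proof -
      have "finite (R \<inter> M)"
        using that assms finite_subset unfolding rhombi_def by blast
      then show ?thesis
        by (simp add: Suc_le_eq card_gt_0_iff)
    qed
    then have "{W \<in> rhombi V. 1 \<le> card (W \<inter> M)} = rhombi V - L"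
      unfolding L_def by blast
    then show ?thesis
      unfolding score_def M_def by simp
  qed
  moreover have "card (rhombi V - L) = card (rhombi V) - card L"
    using fin by (intro card_Diff_subset) (auto simp: L_def)
  ultimately show "card (rhombi V) - (card (rhombi V) div 12 + card ?N) \<le> score V (rhombi V) 1 \<sigma> \<tau>"
    by linarith
qed

theorem theorem14:
  fixes V :: "nat \<Rightarrow> (int \<times> int) set" and n :: "nat \<Rightarrow> nat"
  assumes "\<And>m. finite (V m)"
    and "\<And>m. n m = card (rhombi (V m))"
    and "filterlim n at_top sequentially"
    and "two_dimensional V"
  shows "\<exists>e :: nat \<Rightarrow> real. e \<in> o(\<lambda>m. real (n m)) \<and>
           (\<forall>m. real (SC2 (V m) (rhombi (V m)) 1) \<ge> 11 * real (n m) / 12 - e m)"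
proof (intro exI conjI allI)
  \<comment> \<open>The error term is the number of rhombi within distance 10 of the
    boundary.\<close>
  show "(\<lambda>m. real (card (rhombi_near_boundary (V m) 10))) \<in> o(\<lambda>m. real (n m))"
    using assms(2,4) unfolding two_dimensional_def by simp
  fix m
  \<comment> \<open>Truncated subtraction is safe here: it is never below the real difference that
    has to be bounded.\<close>
  have "n m - (n m div 12 + card (rhombi_near_boundary (V m) 10)) \<le> SC2 (V m) (rhombi (V m)) 1"
    using SC2_ge[OF finite_rhombi[OF assms(1)] grid_pairs_pairing grid_pairs_guarantee[OF assms(1)]]
    unfolding assms(2) .
  moreover have "12 * (n m div 12) \<le> n m"
    by simp
  ultimately show "11 * real (n m) / 12 - real (card (rhombi_near_boundary (V m) 10))
      \<le> real (SC2 (V m) (rhombi (V m)) 1)"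
    by linarith
qed

end
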